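(* Let the polynomials $\psi_n$ be defined by the recurrence in the context. For every $n \geq 1$, the number of monomials (with nonzero coefficient) of $\psi_n$ is at most $P_\Sigma(n) = \sum_{\nu=1}^{n} P(\nu)$, where $P(\nu)$ is the number of partitions of $\nu$.
   Context: Partial Bell polynomials: for $n \geq 1$, $1 \leq k \leq n$, \[ B_{n,k}(y_1,\ldots,y_{n-k+1}) = \sum \frac{n!}{j_1!\cdots j_{n-k+1}!}\prod_{i=1}^{n-k+1}\Bigl(\frac{y_i}{i!}\Bigr)^{j_i}, \] the sum over nonnegative integers $j_i$ with $\sum_i i j_i = n$ and $\sum_i j_i = k$; $B_n = \sum_{k=1}^n B_{n,k}$. Stirling numbers of the first kind $S_1(n,k)$ are defined by $x(x-1)\cdots(x-n+1) = \sum_k S_1(n,k)x^k$, and $(n)_k = n!/(n-k)!$. Put $\sigma^\star_n = (-1)^n B_n(-x_1, -1!\,x_2, \ldots, -(n-1)!\,x_n)$. Define $\psi_0 = 0$ and for $n \geq 1$ \[ \psi_n = n\,\psi_{n-1} + \sigma^\star_n + \Psi_n,\qquad \Psi_n = \sum_{\nu=2}^{n}\sum_{k=0}^{\min(\nu,n-\nu)} (-1)^{\nu+1} S_1(\nu+1,k+1)\,(n)_k\, B_{n-k,\nu}(\psi_1,\ldots,\psi_{n-k-\nu+1}). \] *)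

theory Defs
  imports
    "HOL-Library.Poly_Mapping"
    "HOL-Library.Multiset"
    "HOL-Computational_Algebra.Polynomial"
begin

text \<open>Polynomials over the rationals in the indeterminates \<open>x\<^sub>1, x\<^sub>2, \<dots>\<close>:
  finitely supported maps from monomials (exponent vectors) to coefficients, with the
  convolution product of \<^theory>\<open>HOL-Library.Poly_Mapping\<close>.\<close>

type_synonym qpoly = "(nat \<Rightarrow>\<^sub>0 nat) \<Rightarrow>\<^sub>0 rat"

definition scal :: "rat \<Rightarrow> qpoly" where
  "scal c = Poly_Mapping.single 0 c"

definition indet :: "nat \<Rightarrow> qpoly" where
  "indet i = Poly_Mapping.single (Poly_Mapping.single i 1) 1"

definition num_monomials :: "qpoly \<Rightarrow> nat" where
  "num_monomials p = card (Poly_Mapping.keys p)"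

text \<open>An index tuple \<open>(j\<^sub>1, \<dots>, j\<^sub>n\<^sub>-\<^sub>k\<^sub>+\<^sub>1)\<close> is encoded as a function on
  all naturals that vanishes outside \<open>{1..n - k + 1}\<close>.\<close>

definition bell_indices :: "nat \<Rightarrow> nat \<Rightarrow> (nat \<Rightarrow> nat) set" where
  "bell_indices n k = {j. (\<forall>i. i \<notin> {1..n - k + 1} \<longrightarrow> j i = 0)
      \<and> (\<Sum>i=1..n - k + 1. i * j i) = n \<and> (\<Sum>i=1..n - k + 1. j i) = k}"

lemma finite_bell_indices: "finite (bell_indices n k)"
proof (rule finite_subset)
  show "bell_indices n k \<subseteq>
      {j. \<forall>i. (i \<in> {1..n - k + 1} \<longrightarrow> j i \<in> {..k}) \<and> (i \<notin> {1..n - k + 1} \<longrightarrow> j i = 0)}"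
  proof (intro subsetI CollectI allI conjI impI)
    fix j i
    assume j: "j \<in> bell_indices n k"
    show "j i \<in> {..k}" if "i \<in> {1..n - k + 1}"
      using member_le_sum[of i "{1..n - k + 1}" j] that j by (simp add: bell_indices_def)
    show "j i = 0" if "i \<notin> {1..n - k + 1}"
      using that j unfolding bell_indices_def by blast
  qed
  show "finite {j. \<forall>i. (i \<in> {1..n - k + 1} \<longrightarrow> j i \<in> {..k})
      \<and> (i \<notin> {1..n - k + 1} \<longrightarrow> j i = (0::nat))}"
    by (rule finite_set_of_finite_funs) auto
qed

definition partial_bell :: "nat \<Rightarrow> nat \<Rightarrow> (nat \<Rightarrow> qpoly) \<Rightarrow> qpoly" where
  "partial_bell n k y = (\<Sum>j\<in>bell_indices n k.
      scal (fact n / (\<Prod>i=1..n - k + 1. fact (j i)))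
      * (\<Prod>i=1..n - k + 1. (scal (1 / fact i) * y i) ^ j i))"

definition complete_bell :: "nat \<Rightarrow> (nat \<Rightarrow> qpoly) \<Rightarrow> qpoly" where
  "complete_bell n y = (\<Sum>k=1..n. partial_bell n k y)"

definition stirling1 :: "nat \<Rightarrow> nat \<Rightarrow> int" where
  "stirling1 n k = Polynomial.coeff (\<Prod>i<n. [:- int i, 1:]) k"

definition falling :: "nat \<Rightarrow> nat \<Rightarrow> rat" where
  "falling n k = fact n / fact (n - k)"

definition sigma_star :: "nat \<Rightarrow> qpoly" where
  "sigma_star n = (-1) ^ n * complete_bell n (\<lambda>i. - (scal (fact (i - 1)) * indet i))"

definition Psi_sum :: "nat \<Rightarrow> (nat \<Rightarrow> qpoly) \<Rightarrow> qpoly" where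
  "Psi_sum n y = (\<Sum>\<nu>=2..n. \<Sum>k=0..min \<nu> (n - \<nu>).
      scal ((-1) ^ (\<nu> + 1) * of_int (stirling1 (\<nu> + 1) (k + 1)) * falling n k)
      * partial_bell (n - k) \<nu> y)"

lemma partial_bell_cong:
  assumes "\<And>i. 1 \<le> i \<Longrightarrow> i \<le> n - k + 1 \<Longrightarrow> y i = z i"
  shows "partial_bell n k y = partial_bell n k z"
  unfolding partial_bell_def using assms
  by (intro sum.cong refl arg_cong2[where f = "(*)"] prod.cong) auto

text \<open>\<^const>\<open>Psi_sum\<close> \<open>n\<close> reads only \<open>y\<^sub>1, \<dots>, y\<^sub>n\<^sub>-\<^sub>1\<close>, so the recursion below
  is well-founded.\<close>

lemma Psi_sum_cong [fundef_cong]: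
  assumes "n = m" and "\<And>i. i < m \<Longrightarrow> y i = z i"
  shows "Psi_sum n y = Psi_sum m z"
proof -
  have "partial_bell (m - k) \<nu> y = partial_bell (m - k) \<nu> z"
    if "\<nu> \<in> {2..m}" "k \<in> {0..min \<nu> (m - \<nu>)}" for \<nu> k
    using that by (intro partial_bell_cong assms(2)) auto
  then show ?thesis
    unfolding Psi_sum_def assms(1) by (intro sum.cong refl arg_cong2[where f = "(*)"]) auto
qed

fun psi :: "nat \<Rightarrow> qpoly" where
  "psi 0 = 0"
| "psi (Suc m) = of_nat (Suc m) * psi m + sigma_star (Suc m) + Psi_sum (Suc m) psi"

definition num_partitions :: "nat \<Rightarrow> nat" where
  "num_partitions n = card {M :: nat multiset. 0 \<notin># M \<and> sum_mset M = n}"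

definition P_Sigma :: "nat \<Rightarrow> nat" where
  "P_Sigma n = (\<Sum>\<nu>=1..n. num_partitions \<nu>)"

end

theory Submission
  imports Defs
begin

text \<open>Give \<open>x\<^sub>i\<close> the weight \<open>i\<close>. By induction along the recurrence every monomial of \<open>\<psi>\<^sub>n\<close> has weight
  between 1 and \<open>n\<close>, because substituting polynomials \<open>y\<^sub>i\<close> with weights in \<open>[1, i]\<close> into the partial
  Bell polynomial \<open>B\<^sub>n\<^sub>,\<^sub>k\<close> yields weights in \<open>[k, n]\<close>. The monomials of weight \<open>\<nu>\<close> in
  \<open>x\<^sub>1, x\<^sub>2, \<dots>\<close> are exactly the partitions of \<open>\<nu>\<close>.\<close>

definition monom_weight :: "(nat \<Rightarrow>\<^sub>0 nat) \<Rightarrow> nat" where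
  "monom_weight m = (\<Sum>i\<in>Poly_Mapping.keys m. i * Poly_Mapping.lookup m i)"

text \<open>Lets the weights of several monomials be computed over one common index set, since extra
  indices have exponent 0.\<close>

lemma monom_weight_superset:
  assumes "finite A" "Poly_Mapping.keys m \<subseteq> A"
  shows "monom_weight m = (\<Sum>i\<in>A. i * Poly_Mapping.lookup m i)"
  unfolding monom_weight_def using assms
  by (intro sum.mono_neutral_left) (auto simp: in_keys_iff)

lemma monom_weight_add: "monom_weight (m + m') = monom_weight m + monom_weight m'"
proof -
  let ?A = "Poly_Mapping.keys m \<union> Poly_Mapping.keys m'"
  have "monom_weight (m + m') = (\<Sum>i\<in>?A. i * Poly_Mapping.lookup (m + m') i)"
    using Poly_Mapping.keys_add[of m m'] by (intro monom_weight_superset) auto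
  also have "\<dots> = (\<Sum>i\<in>?A. i * Poly_Mapping.lookup m i) + (\<Sum>i\<in>?A. i * Poly_Mapping.lookup m' i)"
    by (simp add: lookup_add distrib_left sum.distrib)
  also have "\<dots> = monom_weight m + monom_weight m'"
    by (simp add: monom_weight_superset[of ?A])
  finally show ?thesis .
qed

lemma monom_weight_zero [simp]: "monom_weight 0 = 0"
  by (simp add: monom_weight_def)

lemma monom_weight_single [simp]: "monom_weight (Poly_Mapping.single i e) = i * e"
  by (subst monom_weight_superset[of "{i}"]) auto

text \<open>Index 0 contributes nothing to the weight, so \<open>x_0\<close> is excluded explicitly;
  otherwise a monomial could give a partition with parts 0.\<close>

definition weights_between :: "nat \<Rightarrow> nat \<Rightarrow> qpoly set" where
  "weights_between a b = {p. \<forall>m\<in>Poly_Mapping.keys p.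
      Poly_Mapping.lookup m 0 = 0 \<and> a \<le> monom_weight m \<and> monom_weight m \<le> b}"

lemma weights_between_mono:
  assumes "p \<in> weights_between a b" "a' \<le> a" "b \<le> b'"
  shows "p \<in> weights_between a' b'"
  using assms unfolding weights_between_def by fastforce

lemma zero_weights_between [simp]: "0 \<in> weights_between a b"
  by (simp add: weights_between_def)

lemma weights_between_add:
  assumes "p \<in> weights_between a b" "q \<in> weights_between a b"
  shows "p + q \<in> weights_between a b"
  using assms Poly_Mapping.keys_add[of p q] unfolding weights_between_def by blast

lemma weights_between_uminus:
  assumes "p \<in> weights_between a b"
  shows "- p \<in> weights_between a b"
  using assms by (simp add: weights_between_def)

lemma weights_between_sum:
  assumes "\<And>i. i \<in> A \<Longrightarrow> f i \<in> weights_between a b"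
  shows "sum f A \<in> weights_between a b"
  using assms by (induction A rule: infinite_finite_induct) (auto intro: weights_between_add)

text \<open>Every monomial of a product is a product of monomials of the factors, and weight is
  additive; cancellation can only remove monomials.\<close>

lemma weights_between_mult:
  assumes "p \<in> weights_between a b" "q \<in> weights_between c d"
  shows "p * q \<in> weights_between (a + c) (b + d)"
proof -
  have "Poly_Mapping.lookup m 0 = 0 \<and> a + c \<le> monom_weight m \<and> monom_weight m \<le> b + d"
    if "m \<in> Poly_Mapping.keys (p * q)" for m
  proof -
    from that obtain s t where "m = s + t" "s \<in> Poly_Mapping.keys p" "t \<in> Poly_Mapping.keys q"
      using Poly_Mapping.keys_mult[of p q] by blast
    with assms show ?thesis
      unfolding weights_between_def by (fastforce simp: monom_weight_add lookup_add)
  qed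
  then show ?thesis by (simp add: weights_between_def)
qed

lemma scal_weights_between: "scal c \<in> weights_between 0 0"
  by (auto simp: weights_between_def scal_def)

lemma one_weights_between: "1 \<in> weights_between 0 0"
  using scal_weights_between[of 1] by (simp add: scal_def single_one)

lemma weights_between_scal_mult:
  assumes "p \<in> weights_between a b"
  shows "scal c * p \<in> weights_between a b"
  using weights_between_mult[OF scal_weights_between assms] by simp

lemma weights_between_power:
  assumes "p \<in> weights_between a b"
  shows "p ^ e \<in> weights_between (a * e) (b * e)"
  by (induction e) (use assms in \<open>auto intro: weights_between_mult one_weights_between\<close>)

lemma weights_between_prod:
  assumes "\<And>i. i \<in> A \<Longrightarrow> f i \<in> weights_between (g i) (h i)"
  shows "prod f A \<in> weights_between (sum g A) (sum h A)"
  using assms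
  by (induction A rule: infinite_finite_induct)
     (auto intro: weights_between_mult one_weights_between)

lemma indet_weights_between:
  assumes "1 \<le> i"
  shows "indet i \<in> weights_between 1 i"
  using assms by (auto simp: weights_between_def indet_def lookup_single)

text \<open>The power of \<open>y i\<close> with exponent \<open>j i\<close> has weights from
  \<open>j i\<close> to \<open>i * j i\<close>. Summed over \<open>i\<close>, these bounds are
  \<open>k\<close> and \<open>n\<close> by the two constraints on \<open>j\<close>.\<close>

lemma partial_bell_weights_between:
  assumes "\<And>i. 1 \<le> i \<Longrightarrow> i \<le> n - k + 1 \<Longrightarrow> y i \<in> weights_between 1 i"
  shows "partial_bell n k y \<in> weights_between k n"
  unfolding partial_bell_def
proof (intro weights_between_sum weights_between_scal_mult)
  fix j assume j: "j \<in> bell_indices n k"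
  have "(\<Prod>i=1..n - k + 1. (scal (1 / fact i) * y i) ^ j i)
      \<in> weights_between (\<Sum>i=1..n - k + 1. 1 * j i) (\<Sum>i=1..n - k + 1. i * j i)"
    using assms
    by (intro weights_between_prod weights_between_power weights_between_scal_mult) auto
  then show "(\<Prod>i=1..n - k + 1. (scal (1 / fact i) * y i) ^ j i) \<in> weights_between k n"
    using j by (simp add: bell_indices_def)
qed

lemma sigma_star_weights_between: "sigma_star n \<in> weights_between 1 n"
proof -
  let ?y = "\<lambda>i. - (scal (fact (i - 1)) * indet i)"
  have "partial_bell n k ?y \<in> weights_between 1 n" if "k \<in> {1..n}" for k
    by (rule weights_between_mono[OF partial_bell_weights_between])
       (use that in \<open>auto intro!: weights_between_uminus weights_between_scal_mult
          indet_weights_between[simplified]\<close>)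
  then have *: "complete_bell n ?y \<in> weights_between 1 n"
    unfolding complete_bell_def by (rule weights_between_sum)
  show ?thesis
    \<comment> \<open>The sign is a power of a constant of weight 0, so it shifts neither
      bound.\<close>
    using weights_between_mult[OF weights_between_power[OF
        weights_between_uminus[OF one_weights_between], of n] *]
    by (simp add: sigma_star_def)
qed

text \<open>As \<nu> is at least 2, the largest index read, \<open>n - k - \<nu> + 1\<close>, is
  below \<open>n\<close>. The resulting weights lie between \<nu> and \<open>n - k\<close>.\<close>

lemma Psi_sum_weights_between:
  assumes "\<And>i. i < n \<Longrightarrow> y i \<in> weights_between 1 i"
  shows "Psi_sum n y \<in> weights_between 1 n"
  unfolding Psi_sum_def
proof (intro weights_between_sum weights_between_scal_mult)
  fix \<nu> k assume "\<nu> \<in> {2..n}" "k \<in> {0..min \<nu> (n - \<nu>)}"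
  then show "partial_bell (n - k) \<nu> y \<in> weights_between 1 n"
    by (intro weights_between_mono[OF partial_bell_weights_between] assms) auto
qed

text \<open>Strong induction, because \<open>Psi_sum\<close> reads all earlier polynomials. For
  \<open>n = 0\<close> the interval is empty, but the zero polynomial has no monomials to
  check.\<close>

lemma psi_weights_between: "psi n \<in> weights_between 1 n"
proof (induction n rule: less_induct)
  case (less n)
  show ?case
  proof (cases n)
    case (Suc m)
    have "of_nat (Suc m) * psi m = scal (of_nat (Suc m)) * psi m"
      by (simp only: scal_def single_of_nat)
    moreover have "psi m \<in> weights_between 1 n"
      using weights_between_mono[OF less[of m]] Suc by simp
    ultimately have "of_nat (Suc m) * psi m \<in> weights_between 1 n"
      by (simp only: weights_between_scal_mult)
    then show ?thesis
      using Suc less sigma_star_weights_between Psi_sum_weights_between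
      by (simp only: psi.simps) (intro weights_between_add, auto)
  qed simp
qed

text \<open>Positive parts summing to \<open>n\<close> form a list of length at most
  \<open>n\<close> with entries at most \<open>n\<close>. Finiteness matters because
  \<open>card\<close> is 0 on infinite sets.\<close>

lemma finite_partitions: "finite {M :: nat multiset. 0 \<notin># M \<and> sum_mset M = n}"
proof (rule finite_subset)
  show "{M. 0 \<notin># M \<and> sum_mset M = n} \<subseteq> mset ` {xs. set xs \<subseteq> {..n} \<and> length xs \<le> n}"
  proof
    fix M :: "nat multiset" assume M: "M \<in> {M. 0 \<notin># M \<and> sum_mset M = n}"
    obtain xs where xs: "M = mset xs" by (metis ex_mset)
    have "length xs \<le> sum_list xs" if "0 \<notin> set xs" for xs :: "nat list"
      using that by (induction xs) auto
    with M have "length xs \<le> n" "set xs \<subseteq> {..n}"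
      by (auto simp: xs sum_mset_sum_list dest: member_le_sum_list)
    then show "M \<in> mset ` {xs. set xs \<subseteq> {..n} \<and> length xs \<le> n}"
      using xs by blast
  qed
qed (intro finite_imageI finite_lists_length_le finite_atMost)

text \<open>The partition attached to a monomial: the exponent of \<open>x_i\<close> is the
  multiplicity of the part \<open>i\<close>.\<close>

definition monom_mset :: "(nat \<Rightarrow>\<^sub>0 nat) \<Rightarrow> nat multiset" where
  "monom_mset m = Abs_multiset (Poly_Mapping.lookup m)"

lemma count_monom_mset: "count (monom_mset m) = Poly_Mapping.lookup m"
  unfolding monom_mset_def
  using Poly_Mapping.finite_lookup[of m] by (intro Abs_multiset_inverse) simp

lemma inj_monom_mset: "inj monom_mset"
  by (metis count_monom_mset injI poly_mapping_eqI)

lemma sum_mset_sum_count: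
  fixes M :: "nat multiset"
  shows "sum_mset M = (\<Sum>i\<in>set_mset M. i * count M i)"
proof (induction M)
  case (add x M)
  \<comment> \<open>A common index set for both multisets; if \<open>x\<close> is new, its term for
    \<open>M\<close> vanishes.\<close>
  let ?A = "insert x (set_mset M)"
  have "(\<Sum>i\<in>?A. i * count (add_mset x M) i) = (\<Sum>i\<in>?A. i * count M i + (if i = x then i else 0))"
    by (intro sum.cong) auto
  also have "\<dots> = (\<Sum>i\<in>?A. i * count M i) + x"
    by (simp add: sum.distrib)
  also have "(\<Sum>i\<in>?A. i * count M i) = (\<Sum>i\<in>set_mset M. i * count M i)"
    by (intro sum.mono_neutral_right) (auto simp: not_in_iff)
  finally show ?case
    using add by simp
qed simp

lemma sum_mset_monom_mset: "sum_mset (monom_mset m) = monom_weight m"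
proof -
  have "set_mset (monom_mset m) = Poly_Mapping.keys m"
    by (auto simp: set_mset_def count_monom_mset in_keys_iff)
  then show ?thesis
    using sum_mset_sum_count[of "monom_mset m"]
    by (simp add: monom_weight_def count_monom_mset)
qed

theorem theorem1p3:
  fixes n :: nat
  assumes "n \<ge> 1"
  shows "num_monomials (psi n) \<le> P_Sigma n"
proof -
  let ?P = "\<lambda>\<nu>. {M :: nat multiset. 0 \<notin># M \<and> sum_mset M = \<nu>}"
  \<comment> \<open>The weight of a monomial selects \<nu>, and the vanishing exponent at index 0
    rules out parts 0.\<close>
  have "monom_mset ` Poly_Mapping.keys (psi n) \<subseteq> (\<Union>\<nu>\<in>{1..n}. ?P \<nu>)"
    using psi_weights_between[of n]
    by (auto simp: weights_between_def sum_mset_monom_mset count_monom_mset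
        simp flip: count_greater_zero_iff)
  then have "card (Poly_Mapping.keys (psi n)) \<le> card (\<Union>\<nu>\<in>{1..n}. ?P \<nu>)"
    by (intro card_inj_on_le[OF inj_on_subset[OF inj_monom_mset]])
       (auto simp del: UN_simps intro!: finite_partitions)
  also have "\<dots> \<le> (\<Sum>\<nu>=1..n. card (?P \<nu>))"
    by (intro card_UN_le) simp
  finally show ?thesis
    by (simp add: num_monomials_def P_Sigma_def num_partitions_def)
qed

end
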